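(* Let $p$ be a prime with $p\equiv 1\pmod 4$ and let $\alpha$ be a positive integer. Then the number of complete subgraphs of order $3$ in $G_{p^\alpha}$ is $$\mathcal{K}_3(G_{p^{\alpha}})=\frac{p^{3\alpha-2}(p-1)(p-5)}{48}.$$
   Context: For a positive integer $n$, $\mathbb{Z}_n$ denotes the ring of integers modulo $n$ and $\mathbb{Z}_n^{\ast}$ its group of units. The graph $G_n$ has vertex set $\mathbb{Z}_n$, and two distinct vertices $a,b$ are adjacent if and only if $a-b\equiv x^2\pmod n$ for some $x\in\mathbb{Z}_n^{\ast}$ (for $n=p^\alpha$ with $p\equiv1\pmod4$, $-1$ is a square of a unit, so this relation is symmetric). For a graph $G$, $\mathcal{K}_m(G)$ denotes the number of complete subgraphs of order $m$ in $G$. *)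

theory Defs
  imports "HOL-Number_Theory.Residues" "Graph_Theory.Graph_Theory"
begin

text \<open>
  As everywhere in \<^theory>\<open>Graph_Theory.Digraph\<close>, an undirected graph is a symmetric digraph.
  Below, \<open>unit_square_graph n\<close> is symmetric whenever \<open>-1\<close> is the square of a unit modulo \<open>n\<close>;
  for other \<open>n\<close> it is only a digraph. The ring of integers modulo \<open>n\<close> is represented by
  the residues \<open>0, ..., n - 1\<close>.
\<close>

definition unit_square_graph :: "nat \<Rightarrow> int pair_pre_digraph" where
  "unit_square_graph n =
    \<lparr> pverts = carrier (residue_ring (int n)),
      parcs = {(a, b). a \<in> carrier (residue_ring (int n)) \<and> b \<in> carrier (residue_ring (int n)) \<and>
                a \<noteq> b \<and> (\<exists>x \<in> Units (residue_ring (int n)). [a - b = x ^ 2] (mod int n))} \<rparr>"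

text \<open>
  A subgraph has the same head and tail functions as the ambient graph, and the arcs of a complete
  subgraph are all pairs of distinct vertices. So each complete subgraph is counted exactly once.
\<close>

definition num_complete_subgraphs :: "nat \<Rightarrow> ('a, 'b) pre_digraph \<Rightarrow> nat" where
  "num_complete_subgraphs m G = card {H. subgraph H G \<and> complete_digraph m H}"

end

theory Submission
  imports Defs "HOL-Number_Theory.Euler_Criterion"
begin

text \<open>
  Since \<open>p\<close> is odd, squares of units lift from modulus \<open>p\<close> to modulus \<open>p ^ \<alpha>\<close>, so \<open>a\<close> and \<open>b\<close> are
  adjacent iff \<open>e a b = 1\<close>, where \<open>e a b\<close> is the Legendre symbol of \<open>a - b\<close> modulo \<open>p\<close>.
  If \<open>d\<close> is the indicator of congruence modulo \<open>p\<close>, then \<open>1 - d + e\<close> is twice the indicator of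
  adjacency. Hence the number of ordered triangles is an eighth of the sum of
  \<open>(1 - d a b + e a b) (1 - d b c + e b c) (1 - d a c + e a c)\<close>.
  After expanding, the only term that is not elementary is the sum of \<open>e a b * e b c * e a c\<close>, and it
  vanishes because multiplying \<open>a\<close>, \<open>b\<close> and \<open>c\<close> by a nonresidue changes its sign.
\<close>

section \<open>Complete subgraphs, vertex sets and ordered triangles\<close>

text \<open>A subgraph inherits \<open>fst\<close> and \<open>snd\<close> as tail and head
  functions, so its arcs coincide with its \<open>arcs_ends\<close>. Completeness fixes these, hence
  a complete subgraph is determined by its vertex set, and \<open>F\<close> rebuilds it from that
  set.\<close>

lemma num_complete_subgraphs_with_proj:
  assumes "finite (pverts G)" "parcs G \<subseteq> pverts G \<times> pverts G"
  shows "num_complete_subgraphs m (with_proj G) =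
    card {V. V \<subseteq> pverts G \<and> card V = m \<and> {(u, v). u \<in> V \<and> v \<in> V \<and> u \<noteq> v} \<subseteq> parcs G}"
    (is "_ = card ?K")
proof -
  define F where "F V = with_proj \<lparr>pverts = V, parcs = {(u, v). u \<in> V \<and> v \<in> V \<and> u \<noteq> v}\<rparr>" for V :: "'a set"
  have "F ` ?K = {H. subgraph H (with_proj G) \<and> complete_digraph m H}"
  proof (intro equalityI subsetI)
    fix H assume "H \<in> F ` ?K"
    then obtain V where H: "H = F V" and V: "V \<in> ?K" by blast
    have "finite V" using V assms finite_subset by auto
    moreover from this have "finite {(u, v). u \<in> V \<and> v \<in> V \<and> u \<noteq> v}"
      by (auto intro: finite_subset[of _ "V \<times> V"])
    ultimately have "graph H"
      unfolding H F_def
      by unfold_locales (auto intro!: symI simp: symmetric_def arc_to_ends_def)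
    then have "complete_digraph m H" "wf_digraph H"
      using V by (auto simp: complete_digraph_def H F_def graph_def digraph_def fin_digraph_def)
    then show "H \<in> {H. subgraph H (with_proj G) \<and> complete_digraph m H}"
      using V assms by (auto simp: subgraph_def F_def H compatible_def wf_digraph_def)
  next
    fix H assume "H \<in> {H. subgraph H (with_proj G) \<and> complete_digraph m H}"
    then have sub: "subgraph H (with_proj G)" and K: "complete_digraph m H" by auto
    have fin: "graph H" and ends: "arcs_ends H = {(u, v). u \<in> verts H \<and> v \<in> verts H \<and> u \<noteq> v}"
      and "card (verts H) = m"
      using K by (auto simp: complete_digraph_def)
    have "tail H = fst" "head H = snd" using sub by (auto simp: subgraph_def compatible_def)
    have "arcs_ends H = arcs H"
      using \<open>tail H = fst\<close> \<open>head H = snd\<close> by (auto simp: arcs_ends_def arc_to_ends_def)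
    have "H = F (verts H)"
      using \<open>tail H = fst\<close> \<open>head H = snd\<close> ends \<open>arcs_ends H = arcs H\<close> by (simp add: F_def with_proj_def)
    moreover have "verts H \<in> ?K"
      using sub ends \<open>card (verts H) = m\<close> \<open>arcs_ends H = arcs H\<close> by (auto simp: subgraph_def)
    ultimately show "H \<in> F ` ?K" by blast
  qed
  moreover have "inj_on F ?K"
    by (intro inj_onI) (simp add: F_def with_proj_def)
  ultimately show ?thesis
    using card_image[of F ?K] by (simp add: num_complete_subgraphs_def)
qed

text \<open>Sending a triple to its set of entries is 6-to-1: the fibre \<open>fib V\<close>
  consists of the orderings of \<open>V\<close>. Irreflexivity makes the entries of a triangle
  distinct, and symmetry makes the three relations along one ordering cover all six arcs.\<close>

lemma card_ordered_triangles:
  assumes "finite S" and sym: "\<And>u v. R u v \<Longrightarrow> R v u" and irrefl: "\<And>u. \<not> R u u"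
  shows "card {(a, b, c). a \<in> S \<and> b \<in> S \<and> c \<in> S \<and> R a b \<and> R b c \<and> R a c} =
    6 * card {V. V \<subseteq> S \<and> card V = 3 \<and> {(u, v). u \<in> V \<and> v \<in> V \<and> u \<noteq> v} \<subseteq> {(u, v). R u v}}"
    (is "card ?T = 6 * card ?K")
proof -
  define fib where "fib V = {(a, b, c). {a, b, c} = V \<and> a \<noteq> b \<and> b \<noteq> c \<and> a \<noteq> c}" for V :: "'a set"
  have card_fib: "finite (fib V) \<and> card (fib V) = 6" if "V \<in> ?K" for V
  proof -
    obtain a b c where V: "V = {a, b, c}" "a \<noteq> b" "b \<noteq> c" "a \<noteq> c"
      using \<open>V \<in> ?K\<close> card_3_iff[of V] by auto
    have "fib V = {(a,b,c), (a,c,b), (b,a,c), (b,c,a), (c,a,b), (c,b,a)}"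
    proof (intro equalityI subsetI)
      fix t assume "t \<in> fib V"
      then obtain x y z where t: "t = (x, y, z)" "{x, y, z} = V" "x \<noteq> y" "y \<noteq> z" "x \<noteq> z"
        by (auto simp: fib_def)
      then have "x \<in> {a, b, c}" "y \<in> {a, b, c}" "z \<in> {a, b, c}" using V(1) by blast+
      then show "t \<in> {(a,b,c), (a,c,b), (b,a,c), (b,c,a), (c,a,b), (c,b,a)}"
        using t by (elim insertE emptyE) simp_all
    next
      fix t assume "t \<in> {(a,b,c), (a,c,b), (b,a,c), (b,c,a), (c,a,b), (c,b,a)}"
      then show "t \<in> fib V"
        using V by (elim insertE emptyE) (simp_all add: fib_def insert_commute)
    qed
    then show ?thesis using V(2-) by simp
  qed
  have "?T = (\<Union>V\<in>?K. fib V)"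
  proof (intro equalityI subsetI)
    fix t assume "t \<in> ?T"
    then obtain a b c where t: "t = (a, b, c)" "a \<in> S" "b \<in> S" "c \<in> S" "R a b" "R b c" "R a c"
      by auto
    then have "a \<noteq> b" "b \<noteq> c" "a \<noteq> c" using irrefl by auto
    then have "{a, b, c} \<in> ?K" "t \<in> fib {a, b, c}" using t sym by (auto simp: fib_def)
    then show "t \<in> (\<Union>V\<in>?K. fib V)" by blast
  next
    fix t assume "t \<in> (\<Union>V\<in>?K. fib V)"
    then show "t \<in> ?T" by (auto simp: fib_def)
  qed
  moreover have "finite ?K" using \<open>finite S\<close> by simp
  moreover have "card (\<Union>V\<in>?K. fib V) = (\<Sum>V\<in>?K. card (fib V))"
    using \<open>finite ?K\<close> card_fib by (intro card_UN_disjoint) (auto simp: fib_def)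
  ultimately show ?thesis using card_fib by simp
qed

section \<open>Lifting square roots from \<open>p\<close> to its powers\<close>

text \<open>Hensel lifting for \<open>x ^ 2 - a\<close>: the derivative \<open>2 * y\<close> is
  invertible modulo the odd prime \<open>p\<close>, so a root \<open>y\<close> modulo
  \<open>p ^ k\<close> can be corrected by a multiple of \<open>p ^ k\<close>.\<close>

lemma square_unit_lift:
  fixes p a x :: int
  assumes "prime p" "p \<noteq> 2" "coprime x p" "[a = x ^ 2] (mod p)" "k > 0"
  shows "\<exists>y. coprime y p \<and> [a = y ^ 2] (mod p ^ k)"
  using \<open>k > 0\<close>
proof (induction k rule: nat_induct_non_zero)
  case 1
  then show ?case using assms by auto
next
  case (Suc k)
  then obtain y where y: "coprime y p" "[a = y ^ 2] (mod p ^ k)" by blast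
  then obtain m where m: "a - y ^ 2 = p ^ k * m"
    by (auto simp: cong_iff_dvd_diff dvd_def)
  have "coprime 2 p" using assms(1,2) by (intro primes_coprime) auto
  then have "coprime (2 * y) p" using y by simp
  then obtain s where s: "[2 * y * s = 1] (mod p)" using cong_solve_coprime_int by blast
  \<comment> \<open>This \<open>t\<close> solves the linearised equation: it cancels the error
    \<open>p ^ k * m\<close> modulo \<open>p ^ Suc k\<close>.\<close>
  define t where "t = s * m"
  have "[2 * y * t = m] (mod p)"
    using cong_scalar_right[OF s, of m] by (simp add: t_def mult.assoc)
  then obtain r where r: "m - 2 * y * t = p * r"
    by (metis cong_iff_dvd_diff cong_sym dvd_def)
  \<comment> \<open>As \<open>k\<close> is at least 1, the quadratic term
    \<open>t ^ 2 * p ^ (2 * k)\<close> is divisible by \<open>p ^ Suc k\<close>, and the correction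
    leaves \<open>y\<close> unchanged modulo \<open>p\<close>.\<close>
  obtain j where j: "k = Suc j" using Suc by (cases k) auto
  have "a - (y + t * p ^ k) ^ 2 = p ^ k * (m - 2 * y * t) - t ^ 2 * p ^ k * p ^ k"
    using m by (simp add: algebra_simps power2_eq_square)
  also have "\<dots> = p ^ Suc k * (r - t ^ 2 * p ^ j)"
    unfolding r by (simp add: j algebra_simps)
  finally have "[a = (y + t * p ^ k) ^ 2] (mod p ^ Suc k)"
    by (simp add: cong_iff_dvd_diff)
  moreover have "coprime (y + t * p ^ k) p"
  proof -
    have "gcd (y + t * p ^ k) p = gcd p (t * p ^ j * p + y)"
      by (simp add: j algebra_simps gcd.commute[of _ p])
    also have "\<dots> = 1"
      using y(1) by (simp add: gcd_add_mult coprime_iff_gcd_eq_1 gcd.commute[of _ p])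
    finally show ?thesis by (simp add: coprime_iff_gcd_eq_1)
  qed
  ultimately show ?case by blast
qed

section \<open>The Legendre symbol\<close>

lemma Legendre_cong: "[a = b] (mod p) \<Longrightarrow> Legendre a p = Legendre b p"
  unfolding Legendre_def QuadRes_def by (simp add: cong_def)

text \<open>By Euler's criterion both sides agree modulo \<open>p\<close>. They lie in {-1, 0, 1},
  so they differ by at most 2, which is less than \<open>p\<close>.\<close>

lemma Legendre_mult:
  assumes "prime p" "2 < p"
  shows "Legendre (a * b) (int p) = Legendre a (int p) * Legendre b (int p)"
proof -
  have "[Legendre (a * b) p = (a * b) ^ ((p - 1) div 2)] (mod p)"
    using assms by (rule euler_criterion)
  moreover have "[Legendre a p * Legendre b p = a ^ ((p - 1) div 2) * b ^ ((p - 1) div 2)] (mod p)"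
    using assms by (intro cong_mult euler_criterion)
  ultimately have "[Legendre (a * b) p = Legendre a p * Legendre b p] (mod p)"
    by (metis cong_sym cong_trans power_mult_distrib)
  then have "int p dvd Legendre (a * b) p - Legendre a p * Legendre b p"
    by (simp add: cong_iff_dvd_diff)
  moreover have "\<bar>Legendre (a * b) p - Legendre a p * Legendre b p\<bar> \<le> 2"
    by (simp add: Legendre_def)
  ultimately show ?thesis
    using \<open>2 < p\<close> dvd_imp_le_int[of "Legendre (a * b) p - Legendre a p * Legendre b p" "int p"]
    by fastforce
qed

text \<open>Euler's criterion with the even exponent \<open>(p - 1) div 2\<close> makes -1 a
  quadratic residue. This gives the symmetry of adjacency.\<close>

lemma Legendre_uminus:
  assumes "prime p" "[p = 1] (mod 4)"
  shows "Legendre (- a) (int p) = Legendre a (int p)"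
proof -
  have "p \<noteq> 2" using assms(2) by (auto simp: cong_def)
  then have "2 < p" using prime_ge_2_nat[OF assms(1)] by simp
  have "p mod 4 = 1" using assms(2) by (simp add: cong_def)
  then have "even ((p - 1) div 2)" by presburger
  then have "[Legendre (-1) p = 1] (mod p)"
    using euler_criterion[OF assms(1) \<open>2 < p\<close>, of "-1"] by simp
  then have "int p dvd Legendre (-1) p - 1" by (simp add: cong_iff_dvd_diff)
  then have "Legendre (-1) (int p) = 1"
    using \<open>2 < p\<close> zdvd_imp_le[of "int p" 2] by (auto simp: Legendre_def split: if_splits)
  then show ?thesis
    using Legendre_mult[OF assms(1) \<open>2 < p\<close>, of "-1" a] by simp
qed

text \<open>Otherwise squaring would be onto the finite set of residues modulo \<open>p\<close>,
  hence injective, but 1 and \<open>p - 1\<close> are distinct with equal squares.\<close>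

lemma Legendre_nonresidue_exists:
  assumes "prime p" "2 < p"
  shows "\<exists>g. Legendre g (int p) = - 1"
proof (rule ccontr)
  assume none: "\<nexists>g. Legendre g (int p) = - 1"
  have "QuadRes (int p) a" for a
  proof (cases "[a = 0] (mod int p)")
    case True
    then have "[0 ^ 2 = a] (mod int p)" by (simp add: cong_sym)
    then show ?thesis unfolding QuadRes_def by blast
  qed (use none in \<open>auto simp: Legendre_def split: if_splits\<close>)
  then have "{0..<int p} \<subseteq> (\<lambda>x. x ^ 2 mod int p) ` {0..<int p}"
  proof (intro subsetI)
    fix a assume a: "a \<in> {0..<int p}"
    obtain y where "[y ^ 2 = a] (mod int p)" using \<open>\<And>a. QuadRes (int p) a\<close> QuadRes_def by blast
    then have "a = (y mod int p) ^ 2 mod int p" using a by (simp add: cong_def power_mod)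
    then show "a \<in> (\<lambda>x. x ^ 2 mod int p) ` {0..<int p}" using \<open>2 < p\<close> by auto
  qed
  then have "inj_on (\<lambda>x. x ^ 2 mod int p) {0..<int p}"
    by (intro eq_card_imp_inj_on)
      (auto intro!: antisym card_image_le[of "{0..<int p}", simplified] dest: card_mono[rotated])
  moreover have "(int p - 1) ^ 2 mod int p = 1 ^ 2 mod int p"
    by (simp add: power2_eq_square mod_eq_dvd_iff algebra_simps)
  ultimately show False
    using \<open>2 < p\<close> inj_onD[of "\<lambda>x. x ^ 2 mod int p" "{0..<int p}" "int p - 1" 1] by simp
qed

section \<open>Sums over residues\<close>

text \<open>Followed by reduction modulo \<open>n\<close>, \<open>f\<close> permutes the
  representatives, and a periodic \<open>h\<close> does not notice the reduction. It serves for
  translations and for multiplication by a unit.\<close>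

lemma sum_residues_reindex:
  fixes n :: int and h :: "int \<Rightarrow> 'a :: comm_monoid_add"
  assumes "n > 0" and inj: "\<And>x y. [f x = f y] (mod n) \<Longrightarrow> [x = y] (mod n)"
    and periodic: "\<And>x y. [x = y] (mod n) \<Longrightarrow> h x = h y"
  shows "(\<Sum>x\<in>{0..<n}. h (f x)) = (\<Sum>x\<in>{0..<n}. h x)"
proof -
  define g where "g x = f x mod n" for x
  have "inj_on g {0..<n}"
  proof (rule inj_onI)
    fix x y assume "x \<in> {0..<n}" "y \<in> {0..<n}" "g x = g y"
    moreover from \<open>g x = g y\<close> have "[f x = f y] (mod n)" by (simp add: g_def cong_def)
    then have "[x = y] (mod n)" by (rule inj)
    ultimately show "x = y" by (simp add: cong_def)
  qed
  moreover from this have "g ` {0..<n} = {0..<n}"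
    using \<open>n > 0\<close> by (intro endo_inj_surj) (auto simp: g_def)
  ultimately have "(\<Sum>x\<in>{0..<n}. h x) = (\<Sum>x\<in>{0..<n}. h (g x))"
    using sum.reindex[of g "{0..<n}" h] by simp
  also have "\<dots> = (\<Sum>x\<in>{0..<n}. h (f x))"
    by (intro sum.cong refl periodic) (simp add: g_def)
  finally show ?thesis by simp
qed

text \<open>On the class of \<open>a\<close> modulo \<open>p\<close> the function \<open>h\<close>
  is constant, and the class has \<open>q\<close> representatives in the range. Translation by
  \<open>a\<close> turns their count into that of the multiples of \<open>p\<close>.\<close>

lemma sum_residue_class:
  fixes p q a :: int and h :: "int \<Rightarrow> int"
  assumes "p > 0" "q > 0" and periodic: "\<And>x y. [x = y] (mod p) \<Longrightarrow> h x = h y"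
  shows "(\<Sum>c\<in>{0..<p * q}. of_bool ([a = c] (mod p)) * h c) = q * h a"
proof -
  have "(\<Sum>c\<in>{0..<p * q}. of_bool ([a = c] (mod p)) * h c)
      = (\<Sum>c\<in>{0..<p * q}. of_bool (p dvd c - a) * h a)"
    by (intro sum.cong refl) (auto simp: cong_iff_dvd_diff dvd_diff_commute intro!: periodic)
  also have "\<dots> = h a * (\<Sum>c\<in>{0..<p * q}. of_bool (p dvd c - a))"
    by (simp add: sum_distrib_left mult.commute)
  also have "(\<Sum>c\<in>{0..<p * q}. of_bool (p dvd c - a) :: int) = (\<Sum>c\<in>{0..<p * q}. of_bool (p dvd c))"
    using assms(1,2) by (intro sum_residues_reindex[where h = "\<lambda>c. of_bool (p dvd c)"])
      (auto simp: cong_iff_dvd_diff dest: dvd_mult_left dvd_diff_right_iff dvd_diff_left_iff)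
  also have "\<dots> = int (card {c \<in> {0..<p * q}. p dvd c})"
    by (simp add: sum_of_bool_eq Int_def)
  also have "{c \<in> {0..<p * q}. p dvd c} = (*) p ` {0..<q}"
    using assms(1,2) by (auto simp: zero_le_mult_iff elim!: dvdE)
  also have "card \<dots> = nat q"
    using assms(1) by (subst card_image) (auto simp: inj_on_def)
  finally show ?thesis using assms(2) by simp
qed

section \<open>Counting ordered triangles by character sums\<close>

text \<open>Here \<open>n\<close> is the modulus, a positive power of \<open>p\<close>, and
  \<open>q\<close> the size of a residue class modulo \<open>p\<close> inside it. The factor 8
  clears the denominators of three halved indicators.\<close>

lemma card_Legendre_triangles:
  fixes p k :: nat
  defines "q \<equiv> int p ^ k"
  defines "n \<equiv> int p * q"
  assumes "prime p" "[p = 1] (mod 4)"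
  shows "8 * int (card {(a, b, c). a \<in> {0..<n} \<and> b \<in> {0..<n} \<and> c \<in> {0..<n} \<and>
      Legendre (a - b) (int p) = 1 \<and> Legendre (b - c) (int p) = 1 \<and> Legendre (a - c) (int p) = 1}) =
    n * (n - q) * (n - 5 * q)"
proof -
  define D where "D = {0..<n}"
  define e where "e a b = Legendre (a - b) (int p)" for a b
  define d :: "int \<Rightarrow> int \<Rightarrow> int" where "d a b = of_bool ([a = b] (mod int p))" for a b
  have "p \<noteq> 2" using assms(4) by (auto simp: cong_def)
  then have "2 < p" using prime_ge_2_nat[OF assms(3)] by simp
  have pos: "q > 0" "n > 0" using \<open>2 < p\<close> by (auto simp: q_def n_def)
  have [simp]: "int (card D) = n" using pos by (simp add: D_def)
  have e_cong: "e a b = e a' b'" if "[a = a'] (mod int p)" "[b = b'] (mod int p)" for a a' b b'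
    unfolding e_def using that by (intro Legendre_cong cong_diff)
  have cong_n: "[a = b] (mod int p)" if "[a = b] (mod n)" for a b
    using that cong_modulus_mult by (simp add: n_def)
  have e_cong_n: "e a b = e a' b'" if "[a = a'] (mod n)" "[b = b'] (mod n)" for a a' b b'
    using that by (intro e_cong cong_n)
  have e_sym: "e a b = e b a" for a b
    using Legendre_uminus[OF assms(3,4), of "a - b"] by (simp add: e_def)
  have e_sq: "e a b * e a b = 1 - d a b" and d_sq: "d a b * d a b = d a b"
    and de: "d a b * e a b = 0" for a b
    by (auto simp: e_def d_def Legendre_def cong_iff_dvd_diff)
  have e_one: "(of_bool (e a b = 1) :: int) * 2 = 1 - d a b + e a b" for a b
    by (auto simp: e_def d_def Legendre_def cong_iff_dvd_diff)

  obtain g where g: "Legendre g (int p) = - 1"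
    using Legendre_nonresidue_exists[OF assms(3) \<open>2 < p\<close>] by blast
  have "\<not> int p dvd g" using g by (auto simp: Legendre_def cong_iff_dvd_diff)
  then have "coprime g (int p)"
    using assms(3) by (metis coprime_commute prime_imp_coprime prime_nat_int_transfer)
  then have "coprime g n" by (simp add: n_def q_def)
  have e_scale: "e (g * a) (g * b) = - e a b" for a b
    using Legendre_mult[OF assms(3) \<open>2 < p\<close>, of g "a - b"] g by (simp add: e_def algebra_simps)
  \<comment> \<open>Multiplication by the nonresidue \<open>g\<close> permutes the residues modulo
    \<open>n\<close>, while by \<open>e_scale\<close> it flips every symbol.\<close>
  have scale: "(\<Sum>x\<in>D. h (g * x)) = (\<Sum>x\<in>D. h x)"
    if "\<And>x y. [x = y] (mod n) \<Longrightarrow> h x = h y" for h :: "int \<Rightarrow> int"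
    unfolding D_def using \<open>coprime g n\<close> pos that
    by (intro sum_residues_reindex) (auto simp: cong_mult_lcancel)

  have sum_d: "(\<Sum>c\<in>D. d a c * h c) = q * h a"
    if "\<And>x y. [x = y] (mod int p) \<Longrightarrow> h x = h y" for a h
    unfolding D_def n_def d_def using that pos \<open>2 < p\<close> by (intro sum_residue_class) auto
  \<comment> \<open>Translation removes the dependence on \<open>a\<close>; scaling by
    \<open>g\<close> then shows that the sum equals its own negative.\<close>
  have sum_e: "(\<Sum>c\<in>D. e a c) = 0" for a
  proof -
    have "(\<Sum>c\<in>D. e a c) = (\<Sum>c\<in>D. e 0 c)"
    proof -
      have "(\<Sum>c\<in>D. e 0 (c - a)) = (\<Sum>c\<in>D. e 0 c)"
        unfolding D_def using pos e_cong_n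
        by (intro sum_residues_reindex) (auto simp: cong_iff_dvd_diff)
      then show ?thesis by (simp add: e_def)
    qed
    moreover have "(\<Sum>c\<in>D. e (g * 0) (g * c)) = (\<Sum>c\<in>D. e 0 c)"
      by simp (intro scale e_cong_n; simp)
    ultimately show ?thesis unfolding e_scale by (simp add: sum_negf)
  qed
  \<comment> \<open>No closed form of \<open>J\<close> off the diagonal is required: its sums
    against 1, \<open>d\<close> and \<open>e\<close> suffice.\<close>
  define J where "J a b = (\<Sum>c\<in>D. e b c * e a c)" for a b
  have J_cong: "J a b = J a b'" if "[b = b'] (mod int p)" for a b b'
    unfolding J_def using that by (intro sum.cong refl arg_cong2[of _ _ _ _ "(*)"] e_cong) auto
  have sum_eJ: "(\<Sum>a\<in>D. \<Sum>b\<in>D. e a b * J a b) = 0"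
  proof -
    define P where "P a b c = e a b * (e b c * e a c)" for a b c
    have P_cong: "P a b c = P a' b' c'"
      if "[a = a'] (mod n)" "[b = b'] (mod n)" "[c = c'] (mod n)" for a a' b b' c c'
      unfolding P_def using that by (intro arg_cong2[of _ _ _ _ "(*)"] e_cong_n)
    \<comment> \<open>The factor \<open>g\<close> is removed one variable at a time, innermost sum
      first. Since \<open>P\<close> is a product of three symbols, the left-hand side is also the
      negative of the unscaled sum.\<close>
    have "(\<Sum>a\<in>D. \<Sum>b\<in>D. \<Sum>c\<in>D. P (g * a) (g * b) (g * c)) =
        (\<Sum>a\<in>D. \<Sum>b\<in>D. \<Sum>c\<in>D. P (g * a) (g * b) c)"
      by (intro sum.cong refl scale P_cong) auto
    also have "\<dots> = (\<Sum>a\<in>D. \<Sum>b\<in>D. \<Sum>c\<in>D. P (g * a) b c)"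
      by (intro sum.cong refl scale[of "\<lambda>b. \<Sum>c\<in>D. P _ b c"] P_cong) auto
    also have "\<dots> = (\<Sum>a\<in>D. \<Sum>b\<in>D. \<Sum>c\<in>D. P a b c)"
      by (intro sum.cong refl scale[of "\<lambda>a. \<Sum>b\<in>D. \<Sum>c\<in>D. P a b c"] P_cong) auto
    finally have "(\<Sum>a\<in>D. \<Sum>b\<in>D. \<Sum>c\<in>D. P a b c) = 0"
      by (simp add: P_def e_scale sum_negf)
    then show ?thesis by (simp add: P_def J_def sum_distrib_left)
  qed
  have sum_J: "(\<Sum>b\<in>D. J a b) = 0" for a
  proof -
    have "(\<Sum>b\<in>D. J a b) = (\<Sum>c\<in>D. (\<Sum>b\<in>D. e c b) * e a c)"
      unfolding J_def by (subst sum.swap) (simp add: sum_distrib_right e_sym)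
    then show ?thesis by (simp add: sum_e)
  qed
  have sum_d1: "(\<Sum>c\<in>D. d a c) = q" for a
    using sum_d[of "\<lambda>_. 1" a] by simp
  have J_diag: "J a a = n - q" for a
    unfolding J_def by (simp add: e_sq sum_subtractf sum_d1)
  \<comment> \<open>The factor \<open>d a b\<close> keeps only \<open>b\<close> congruent to
    \<open>a\<close>, where \<open>J a b\<close> takes its diagonal value.\<close>
  have sum_dJ: "(\<Sum>b\<in>D. d a b * J a b) = q * (n - q)" for a
    using sum_d[of "J a" a] J_cong J_diag by metis

  have inner: "(\<Sum>c\<in>D. (1 - d b c + e b c) * (1 - d a c + e a c)) =
      n - 2 * q + q * d a b - 2 * q * e a b + J a b" for a b
  proof -
    have "(\<Sum>c\<in>D. (1 - d b c + e b c) * (1 - d a c + e a c)) =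
        (\<Sum>c\<in>D. 1 - d a c + e a c - d b c * (1 - d a c + e a c) + e b c - d a c * e b c + e b c * e a c)"
      by (intro sum.cong refl) (simp add: algebra_simps)
    also have "\<dots> = n - q - q * (1 - d a b + e a b) - q * e b a + J a b"
    proof -
      have "(\<Sum>c\<in>D. d b c * (1 - d a c + e a c)) = q * (1 - d a b + e a b)"
      proof (rule sum_d)
        fix x y assume "[x = y] (mod int p)"
        then show "1 - d a x + e a x = 1 - d a y + e a y"
          using e_cong[of a a x y] by (simp add: d_def cong_def)
      qed
      moreover have "(\<Sum>c\<in>D. d a c * e b c) = q * e b a"
        by (rule sum_d) (simp add: e_cong)
      ultimately show ?thesis
        by (simp add: sum.distrib sum_subtractf sum_d1 sum_e flip: J_def)
    qed
    finally show ?thesis by (simp add: e_sym[of b a] algebra_simps)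
  qed

  let ?T = "{(a, b, c). a \<in> D \<and> b \<in> D \<and> c \<in> D \<and> e a b = 1 \<and> e b c = 1 \<and> e a c = 1}"
  have "finite D" by (simp add: D_def)
  have "int (card ?T) = (\<Sum>(a, b, c)\<in>D \<times> D \<times> D. of_bool (e a b = 1 \<and> e b c = 1 \<and> e a c = 1))"
    using \<open>finite D\<close>
    by (simp add: case_prod_unfold sum_of_bool_eq) (intro arg_cong[of _ _ card]; auto)
  also have "\<dots> = (\<Sum>a\<in>D. \<Sum>b\<in>D. \<Sum>c\<in>D. of_bool (e a b = 1 \<and> e b c = 1 \<and> e a c = 1))"
    by (simp add: sum.cartesian_product)
  finally have "8 * int (card ?T) =
      (\<Sum>a\<in>D. \<Sum>b\<in>D. \<Sum>c\<in>D. (of_bool (e a b = 1) * 2) *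
        ((of_bool (e b c = 1) * 2) * (of_bool (e a c = 1) * 2)))"
    by (simp add: sum_distrib_left of_bool_conj mult_ac)
  \<comment> \<open>Only two of the three factors involve \<open>c\<close>, so the sum over
    \<open>c\<close> is \<open>inner\<close>.\<close>
  also have "\<dots> = (\<Sum>a\<in>D. \<Sum>b\<in>D. (1 - d a b + e a b) * (n - 2 * q + q * d a b - 2 * q * e a b + J a b))"
    unfolding e_one by (simp only: inner flip: sum_distrib_left)
  \<comment> \<open>The relations for \<open>e * e\<close>, \<open>d * d\<close> and
    \<open>d * e\<close> reduce the product to terms whose sums are all known.\<close>
  also have "\<dots> = (\<Sum>a\<in>D. \<Sum>b\<in>D. (n - 4 * q) + (n - 4 * q) * e a b + J a b
      - (n - 4 * q) * d a b - d a b * J a b + e a b * J a b)"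
  proof (intro sum.cong refl)
    fix a b
    have "(1 - d a b + e a b) * (n - 2 * q + q * d a b - 2 * q * e a b + J a b) =
      (n - 2 * q) + q * d a b - 2 * q * e a b + J a b - (n - 2 * q) * d a b - q * (d a b * d a b)
      + 3 * q * (d a b * e a b) - d a b * J a b + (n - 2 * q) * e a b - 2 * q * (e a b * e a b)
      + e a b * J a b"
      by (simp add: algebra_simps)
    also have "\<dots> = (n - 4 * q) + (n - 4 * q) * e a b + J a b - (n - 4 * q) * d a b - d a b * J a b + e a b * J a b"
      unfolding e_sq d_sq de by (simp add: algebra_simps)
    finally show "(1 - d a b + e a b) * (n - 2 * q + q * d a b - 2 * q * e a b + J a b) =
      (n - 4 * q) + (n - 4 * q) * e a b + J a b - (n - 4 * q) * d a b - d a b * J a b + e a b * J a b" .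
  qed
  \<comment> \<open>The terms in \<open>e\<close>, \<open>J\<close> and \<open>e * J\<close> sum to
    0. The constant, \<open>d\<close> and \<open>d * J\<close> terms remain, and the sum over
    \<open>a\<close> supplies the outer factor \<open>n\<close>.\<close>
  also have "\<dots> = n * (n * (n - 4 * q) - (n - 4 * q) * q - q * (n - q))"
    by (simp add: sum.distrib sum_subtractf sum_J sum_dJ sum_eJ sum_e sum_d1 flip: sum_distrib_left)
  also have "\<dots> = n * (n - q) * (n - 5 * q)"
    by (simp add: algebra_simps)
  finally show ?thesis by (simp add: D_def e_def)
qed

section \<open>Adjacency in terms of the Legendre symbol, and the final count\<close>

text \<open>A unit square modulo \<open>p ^ k\<close> reduces to a nonzero square modulo
  \<open>p\<close>. Conversely a root modulo \<open>p\<close> of such a square is prime to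
  \<open>p\<close> and lifts by \<open>square_unit_lift\<close>; it is then reduced to a
  representative.\<close>

lemma unit_square_iff_Legendre:
  fixes p k :: nat and a :: int
  assumes "prime p" "p \<noteq> 2" "k > 0"
  shows "(\<exists>x\<in>Units (residue_ring (int (p ^ k))). [a = x ^ 2] (mod int (p ^ k))) \<longleftrightarrow>
    Legendre a (int p) = 1"
proof -
  have "1 < int (p ^ k)" using assms prime_gt_1_nat by (simp add: one_less_power)
  then interpret residues "int (p ^ k)" "residue_ring (int (p ^ k))"
    by (simp add: residues_def)
  have prime: "prime (int p)" using assms(1) by simp
  show ?thesis
  proof
    assume "\<exists>x\<in>Units (residue_ring (int (p ^ k))). [a = x ^ 2] (mod int (p ^ k))"
    then obtain x where "coprime x (int p ^ k)" and x: "[a = x ^ 2] (mod int p ^ k)"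
      using res_units_eq by auto
    then have "coprime x (int p)" using \<open>k > 0\<close> by simp
    then have "\<not> int p dvd x ^ 2"
      using prime by (metis coprime_absorb_right not_prime_unit prime_dvd_power)
    moreover have "[a = x ^ 2] (mod int p)"
      using x \<open>k > 0\<close> by (metis cong_dvd_modulus dvd_power)
    ultimately show "Legendre a (int p) = 1"
      unfolding Legendre_def QuadRes_def
      by (metis cong_0_iff cong_sym cong_trans)
  next
    assume L: "Legendre a (int p) = 1"
    then have "QuadRes (int p) a" "\<not> int p dvd a"
      by (auto simp: Legendre_def cong_0_iff split: if_splits)
    then obtain x where x: "[a = x ^ 2] (mod int p)"
      unfolding QuadRes_def using cong_sym by blast
    then have "\<not> int p dvd x ^ 2" using \<open>\<not> int p dvd a\<close> cong_dvd_iff by blast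
    then have "\<not> int p dvd x" by (auto simp: power2_eq_square)
    then have "coprime x (int p)" using prime by (metis coprime_commute prime_imp_coprime)
    then obtain y where y: "coprime y (int p)" "[a = y ^ 2] (mod int p ^ k)"
      using square_unit_lift[OF prime _ _ x \<open>k > 0\<close>] assms(2) by auto
    then have "y mod int (p ^ k) \<in> Units (residue_ring (int (p ^ k)))"
      using \<open>1 < int (p ^ k)\<close> by (intro mod_in_res_units) auto
    moreover have "[a = (y mod int (p ^ k)) ^ 2] (mod int (p ^ k))"
      using y(2) by (simp add: cong_def power_mod)
    ultimately show "\<exists>x\<in>Units (residue_ring (int (p ^ k))). [a = x ^ 2] (mod int (p ^ k))" by blast
  qed
qed

theorem theorem1p1:
  fixes p \<alpha> :: nat
  assumes "prime p" and "[p = 1] (mod 4)" and "\<alpha> > 0"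
  shows "real (num_complete_subgraphs 3 (with_proj (unit_square_graph (p ^ \<alpha>)))) =
    real p ^ (3 * \<alpha> - 2) * (real p - 1) * (real p - 5) / 48"
proof -
  define D where "D = {0..<int (p ^ \<alpha>)}"
  define R where "R a b \<longleftrightarrow> Legendre (a - b) (int p) = 1" for a b
  have "p \<noteq> 2" using assms(2) by (auto simp: cong_def)
  have irrefl: "\<not> R a a" for a by (simp add: R_def Legendre_def)
  have sym: "R a b \<Longrightarrow> R b a" for a b
    using Legendre_uminus[OF assms(1,2), of "a - b"] by (simp add: R_def)
  have verts: "pverts (unit_square_graph (p ^ \<alpha>)) = D"
    by (auto simp: unit_square_graph_def residue_ring_def D_def)
  have arcs: "parcs (unit_square_graph (p ^ \<alpha>)) = {(a, b). a \<in> D \<and> b \<in> D \<and> R a b}"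
  proof -
    have "carrier (residue_ring (int (p ^ \<alpha>))) = D"
      by (auto simp: residue_ring_def D_def)
    then show ?thesis
      unfolding unit_square_graph_def unit_square_iff_Legendre[OF assms(1) \<open>p \<noteq> 2\<close> assms(3)]
      using irrefl by (auto simp: R_def)
  qed
  obtain k where k: "\<alpha> = Suc k" using assms(3) by (cases \<alpha>) auto
  define N where "N = num_complete_subgraphs 3 (with_proj (unit_square_graph (p ^ \<alpha>)))"
  have "N = card {V. V \<subseteq> D \<and> card V = 3 \<and>
      {(u, v). u \<in> V \<and> v \<in> V \<and> u \<noteq> v} \<subseteq> {(a, b). a \<in> D \<and> b \<in> D \<and> R a b}}"
    unfolding N_def by (subst num_complete_subgraphs_with_proj) (auto simp: verts arcs D_def)
  also have "\<dots> = card {V. V \<subseteq> D \<and> card V = 3 \<and>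
      {(u, v). u \<in> V \<and> v \<in> V \<and> u \<noteq> v} \<subseteq> {(u, v). R u v}}"
    by (intro arg_cong[of _ _ card] Collect_cong) blast
  finally have "6 * N = card {(a, b, c). a \<in> D \<and> b \<in> D \<and> c \<in> D \<and> R a b \<and> R b c \<and> R a c}"
    using card_ordered_triangles[of D R] sym irrefl by (simp add: D_def)
  \<comment> \<open>48 is 6 orderings of a triangle times the factor 8 of the character sum.\<close>
  then have "48 * int N = 8 * int (card {(a, b, c). a \<in> D \<and> b \<in> D \<and> c \<in> D \<and> R a b \<and> R b c \<and> R a c})"
    by linarith
  also have "\<dots> = int p * int p ^ k * (int p * int p ^ k - int p ^ k) * (int p * int p ^ k - 5 * int p ^ k)"
    using card_Legendre_triangles[OF assms(1,2), of k] by (simp add: R_def D_def k)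
  \<comment> \<open>Each of the three factors contributes \<open>p ^ k\<close> and the first one a
    further \<open>p\<close>, so the exponent is \<open>3 * k + 1\<close>, which is
    \<open>3 * \<alpha> - 2\<close>.\<close>
  also have "\<dots> = int p ^ (3 * \<alpha> - 2) * (int p - 1) * (int p - 5)"
    by (simp add: k algebra_simps power_add power_mult power3_eq_cube power2_eq_square)
  finally have "real_of_int (48 * int N) = real_of_int (int p ^ (3 * \<alpha> - 2) * (int p - 1) * (int p - 5))"
    by (rule arg_cong)
  then show ?thesis by (simp add: N_def)
qed

end
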